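(* Let $t \geq 2$. Let $A,B$ be two families of axis-parallel rectangles in the plane with $|A|=n$, $|B|=m$, such that $A \cup B$ is in general position. Let $G_{A,B}$ be the bipartite graph with parts $A$ and $B$ in which $a\in A$ and $b\in B$ are adjacent if and only if $a\cap b\neq\emptyset$. If $G_{A,B}$ is $K_{t,t}$-free, then $$|E(G_{A,B})|=O\left(t(n+m) \frac{\log (n+m)}{\log \log (n+m)} + t^6 n+tm \right),$$ where the implied constant is absolute.
   Context: General position means that no two edges of rectangles in $A\cup B$ lie on the same vertical or horizontal line. A bipartite graph is $K_{t,t}$-free if it contains no complete bipartite subgraph with $t$ vertices on each side. *)

theory Defs
  imports "HOL-Analysis.Analysis"
begin

definition axis_parallel_rectangle :: "(real \<times> real) set \<Rightarrow> bool" where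
  "axis_parallel_rectangle R \<longleftrightarrow>
     (\<exists>a b c d. a < b \<and> c < d \<and> R = {a..b} \<times> {c..d})"

definition vertical_line :: "real \<Rightarrow> (real \<times> real) set" where
  "vertical_line s = {p. fst p = s}"

definition horizontal_line :: "real \<Rightarrow> (real \<times> real) set" where
  "horizontal_line s = {p. snd p = s}"

text \<open>Edges are tagged with their rectangle, so that two different rectangles
  sharing one and the same segment as an edge also violate general position.\<close>

definition general_position :: "(real \<times> real) set set \<Rightarrow> bool" where
  "general_position F \<longleftrightarrow>
     (\<forall>R\<in>F. \<forall>R'\<in>F. \<forall>e e'. e edge_of R \<and> e' edge_of R' \<and> (R, e) \<noteq> (R', e') \<longrightarrow>
        \<not> (\<exists>s. e \<subseteq> vertical_line s \<and> e' \<subseteq> vertical_line s) \<and>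
        \<not> (\<exists>s. e \<subseteq> horizontal_line s \<and> e' \<subseteq> horizontal_line s))"

text \<open>A bipartite graph with parts \<open>A\<close>, \<open>B\<close> is given by its edge set, a subset of \<open>A \<times> B\<close>.
  The parts are tagged by the position in the pair, so a rectangle belonging to both
  families gives one vertex on either side.\<close>

definition intersection_edges :: "'a set set \<Rightarrow> 'a set set \<Rightarrow> ('a set \<times> 'a set) set" where
  "intersection_edges A B = {(a, b). a \<in> A \<and> b \<in> B \<and> a \<inter> b \<noteq> {}}"

definition Ktt_free :: "nat \<Rightarrow> 'a set \<Rightarrow> 'b set \<Rightarrow> ('a \<times> 'b) set \<Rightarrow> bool" where
  "Ktt_free t A B E \<longleftrightarrow>
     \<not> (\<exists>S T. S \<subseteq> A \<and> T \<subseteq> B \<and> card S = t \<and> card T = t \<and> S \<times> T \<subseteq> E)"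

end

theory Submission
  imports Defs
begin

text \<open>
  An overlapping pair of rectangles has overlapping \<open>y\<close>-intervals, and the left end of one of the
  two \<open>x\<close>-intervals lies in the other. So it suffices to count pairs \<open>(u, w)\<close> with overlapping
  \<open>y\<close>-intervals for which a point \<open>x u\<close> lies in an interval \<open>[l w, r w]\<close>.

  If the condition on \<open>x\<close> is one-sided, the count is linear: if \<open>u\<close> has at least \<open>2t\<close>
  competitors further inside the range \<open>w\<close>, then \<open>t\<close> of them lie below or \<open>t\<close> of them lie above \<open>u\<close>,
  and the neighbourhoods arising in this way form a chain, so that fewer than \<open>t\<close> ranges \<open>w\<close> can do
  this on either side; the other pairs number at most \<open>2t\<close> per range.

  In general, write the ranks of the points \<open>x u\<close> in base \<open>b\<close>. Each interval is cut at the finest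
  level at which its ends fall into different blocks, giving two one-sided pieces and at most \<open>b\<close>
  full blocks. A point is charged once for each of the \<open>D\<close> levels, but an interval is
  charged on a single level only. This gives \<open>O(t (D |U| + b |W|))\<close> edges with \<open>b ^ D \<ge> |U|\<close>, and
  \<open>b\<close> of order \<open>sqrt (log N)\<close> balances the terms.
\<close>

section \<open>\<open>K_{t,t}\<close>-free graphs and counting edges by fibres\<close>

lemma Ktt_free_mono:
  assumes "Ktt_free t A B E" "A' \<subseteq> A" "B' \<subseteq> B" "E' \<subseteq> E"
  shows "Ktt_free t A' B' E'"
  using assms unfolding Ktt_free_def by (metis subset_trans)

lemma Ktt_free_converse:
  assumes "Ktt_free t A B E"
  shows "Ktt_free t B A (E\<inverse>)"
  unfolding Ktt_free_def
proof (intro notI, elim exE conjE)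
  fix S T assume "S \<subseteq> B" "T \<subseteq> A" "card S = t" "card T = t" "S \<times> T \<subseteq> E\<inverse>"
  moreover from this have "T \<times> S \<subseteq> E" by auto
  ultimately show False using assms unfolding Ktt_free_def by blast
qed

lemma sum_card_le_double_count:
  assumes "finite I" "finite W" "\<And>w. w \<in> W \<Longrightarrow> card {i \<in> I. Q w i} \<le> K"
  shows "(\<Sum>i\<in>I. card {w \<in> W. Q w i}) \<le> K * card W"
proof -
  have "(\<Sum>i\<in>I. card {w \<in> W. Q w i}) = (\<Sum>i\<in>I. \<Sum>w\<in>W. if Q w i then 1 else 0)"
    using assms by (simp add: sum.If_cases Int_def)
  also have "\<dots> = (\<Sum>w\<in>W. \<Sum>i\<in>I. if Q w i then 1 else 0)"
    by (rule sum.swap)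
  also have "\<dots> = (\<Sum>w\<in>W. card {i \<in> I. Q w i})"
    using assms by (simp add: sum.If_cases Int_def)
  also have "\<dots> \<le> (\<Sum>w\<in>W. K)" by (intro sum_mono assms)
  finally show ?thesis by (simp add: mult.commute)
qed

lemma card_le_right_fibers:
  assumes "finite P" "finite W" "F \<subseteq> P \<times> W" "\<And>w. w \<in> W \<Longrightarrow> card {p \<in> P. (p, w) \<in> F} \<le> K"
  shows "card F \<le> K * card W"
proof -
  have "F = (\<Union>w\<in>W. {p \<in> P. (p, w) \<in> F} \<times> {w})" (is "_ = ?G") using assms(3) by auto
  then have "card F = card ?G" by (rule arg_cong)
  also have "\<dots> \<le> (\<Sum>w\<in>W. card ({p \<in> P. (p, w) \<in> F} \<times> {w}))"
    by (rule card_UN_le[OF assms(2)])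
  also have "\<dots> \<le> (\<Sum>w\<in>W. K)"
    using assms(4) by (intro sum_mono) (simp add: card_cartesian_product)
  finally show ?thesis by (simp add: mult.commute)
qed

lemma card_le_left_fibers:
  assumes "finite P" "finite W" "F \<subseteq> P \<times> W" "\<And>p. p \<in> P \<Longrightarrow> card {w \<in> W. (p, w) \<in> F} \<le> K"
  shows "card F \<le> K * card P"
  using card_le_right_fibers[of W P "F\<inverse>" K] assms by (auto simp: card_inverse)

text \<open>Among \<open>t\<close> vertices of \<open>V\<close>, the one with the smallest set
  \<open>N w\<close> has, by the chain condition, its set inside all the others. So \<open>t\<close>
  elements of this set are joined to all \<open>t\<close> vertices, a forbidden subgraph.\<close>

lemma Ktt_free_chain_card_less:
  assumes free: "Ktt_free t P W E" and "finite V" "V \<subseteq> W"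
    and chain: "\<And>v w. v \<in> V \<Longrightarrow> w \<in> V \<Longrightarrow> N v \<subseteq> N w \<or> N w \<subseteq> N v"
    and N: "\<And>w. w \<in> V \<Longrightarrow> finite (N w) \<and> N w \<subseteq> P \<and> N w \<times> {w} \<subseteq> E \<and> t \<le> card (N w)"
  shows "card V < t"
proof (rule ccontr)
  assume "\<not> card V < t"
  then obtain T where T: "T \<subseteq> V" "card T = t" "finite T"
    using obtain_subset_with_card_n[of t V] by (metis not_less)
  \<comment> \<open>For \<open>t = 0\<close> the empty sets would already be a forbidden pair. Hence
    \<open>T\<close> is nonempty and a minimum over it exists.\<close>
  have "t \<noteq> 0" using free unfolding Ktt_free_def by (auto dest!: spec[of _ "{}"])
  then have "T \<noteq> {}" using T by auto
  then obtain w where w: "w \<in> T" "\<And>v. v \<in> T \<Longrightarrow> card (N w) \<le> card (N v)"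
    using arg_min_if_finite(1)[OF T(3), of "\<lambda>v. card (N v)"]
      arg_min_least[OF T(3), of _ "\<lambda>v. card (N v)"] by blast
  have sub: "N w \<subseteq> N v" if "v \<in> T" for v
    using chain[of w v] w that T N[of v] N[of w] by (metis card_seteq subset_iff)
  have "t \<le> card (N w)" using N w T by blast
  then obtain S where S: "S \<subseteq> N w" "card S = t" by (rule obtain_subset_with_card_n)
  have "S \<times> T \<subseteq> E" using sub S N T by blast
  moreover have "S \<subseteq> P" using S N w T by blast
  ultimately show False using free S T \<open>V \<subseteq> W\<close> unfolding Ktt_free_def by blast
qed

section \<open>Linear bounds for one-sided conditions\<close>

lemma card_three_sided_le:
  fixes f y :: "'a \<Rightarrow> real" and g y1 y2 :: "'b \<Rightarrow> real"
  defines "H p w \<equiv> g w \<le> f p \<and> y1 w \<le> y p \<and> y p \<le> y2 w"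
  assumes fin: "finite P" "finite W"
    and free: "Ktt_free t P W {(p, w). p \<in> P \<and> w \<in> W \<and> H p w}"
  shows "card {(p, w). p \<in> P \<and> w \<in> W \<and> H p w} \<le> 2 * t * (card P + card W)"
proof -
  define E where "E = {(p, w). p \<in> P \<and> w \<in> W \<and> H p w}"
  define below where "below p w = {q \<in> P. f p \<le> f q \<and> y1 w \<le> y q \<and> y q \<le> y p}" for p w
  define above where "above p w = {q \<in> P. f p \<le> f q \<and> y p \<le> y q \<and> y q \<le> y2 w}" for p w
  define inner where "inner p w = {q \<in> P. f p \<le> f q \<and> y1 w \<le> y q \<and> y q \<le> y2 w}" for p w
  define Eb where "Eb = {(p, w) \<in> E. t \<le> card (below p w)}"
  define Ea where "Ea = {(p, w) \<in> E. t \<le> card (above p w)}"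
  define El where "El = {(p, w) \<in> E. card (inner p w) < 2 * t}"
  have finE: "finite E" unfolding E_def by (rule finite_subset[OF _ finite_cartesian_product[OF fin]]) auto
  have b: "card Eb \<le> t * card P"
  proof (rule card_le_left_fibers[OF fin])
    show "Eb \<subseteq> P \<times> W" by (auto simp: Eb_def E_def)
    fix p assume "p \<in> P"
    \<comment> \<open>For fixed \<open>p\<close>, the set \<open>below p w\<close> depends on
      \<open>w\<close> only through \<open>y1 w\<close>, which gives the chain. Its points are
      neighbours of \<open>w\<close> because \<open>g w \<le> f p\<close> and
      \<open>y p \<le> y2 w\<close>. The same works for \<open>above\<close> with
      \<open>y2 w\<close>.\<close>
    have "card {w \<in> W. (p, w) \<in> Eb} < t"
      by (rule Ktt_free_chain_card_less[OF free, where N = "below p"])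
        (use fin in \<open>auto simp: Eb_def E_def below_def H_def\<close>)
    then show "card {w \<in> W. (p, w) \<in> Eb} \<le> t" by simp
  qed
  have a: "card Ea \<le> t * card P"
  proof (rule card_le_left_fibers[OF fin])
    show "Ea \<subseteq> P \<times> W" by (auto simp: Ea_def E_def)
    fix p assume "p \<in> P"
    have "card {w \<in> W. (p, w) \<in> Ea} < t"
      by (rule Ktt_free_chain_card_less[OF free, where N = "above p"])
        (use fin in \<open>auto simp: Ea_def E_def above_def H_def\<close>)
    then show "card {w \<in> W. (p, w) \<in> Ea} \<le> t" by simp
  qed
  have l: "card El \<le> (2 * t) * card W"
  proof (rule card_le_right_fibers[OF fin])
    show "El \<subseteq> P \<times> W" by (auto simp: El_def E_def)
    fix w assume "w \<in> W"
    let ?L = "{p \<in> P. (p, w) \<in> El}"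
    show "card ?L \<le> 2 * t"
    proof (cases "?L = {}")
      case False
      have finL: "finite ?L" using fin by simp
      \<comment> \<open>For the element \<open>p\<close> of \<open>?L\<close> with the least
        \<open>f\<close>, all of \<open>?L\<close> lies in \<open>inner p w\<close>, and this set is
        small since \<open>(p, w) \<in> El\<close>.\<close>
      obtain p where p: "p \<in> ?L" "\<And>q. q \<in> ?L \<Longrightarrow> f p \<le> f q"
        using arg_min_if_finite(1)[OF finL False, of f] arg_min_least[OF finL False, of _ f] by blast
      have "?L \<subseteq> inner p w" using p(2) by (auto simp: El_def E_def inner_def H_def)
      then have "card ?L \<le> card (inner p w)"
        by (intro card_mono) (use fin in \<open>auto simp: inner_def\<close>)
      then show ?thesis using p(1) by (auto simp: El_def)
    next
      case True
      then show ?thesis by (simp only: card.empty)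
    qed
  qed
  have "E \<subseteq> El \<union> (Eb \<union> Ea)"
  proof (rule subrelI)
    fix p w assume e: "(p, w) \<in> E"
    have "inner p w \<subseteq> below p w \<union> above p w"
      by (auto simp: inner_def below_def above_def)
    then have "card (inner p w) \<le> card (below p w) + card (above p w)"
      by (intro order_trans[OF card_mono card_Un_le]) (use fin in \<open>auto simp: below_def above_def\<close>)
    then have "card (inner p w) < 2 * t \<or> t \<le> card (below p w) \<or> t \<le> card (above p w)"
      by linarith
    then show "(p, w) \<in> El \<union> (Eb \<union> Ea)" using e by (auto simp: El_def Ea_def Eb_def)
  qed
  then have "card E \<le> card (El \<union> (Eb \<union> Ea))"
    by (intro card_mono) (auto intro: finite_subset[OF _ finE] simp: El_def Ea_def Eb_def)
  also have "\<dots> \<le> card El + (card Eb + card Ea)"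
    by (meson add_left_mono card_Un_le order_trans)
  also have "\<dots> \<le> 2 * t * (card P + card W)"
    using a b l by (simp add: algebra_simps)
  finally show ?thesis by (simp add: E_def)
qed

text \<open>When two intervals overlap, the lower end of one lies in the other, so each edge is of
  one of two three-sided types. In the second type points and ranges swap roles, and negating
  \<open>f\<close> and \<open>g\<close> restores the direction of the one-sided condition.\<close>

lemma card_one_sided_overlap_le:
  fixes f c d :: "'a \<Rightarrow> real" and g c' d' :: "'b \<Rightarrow> real"
  assumes fin: "finite U" "finite W"
    and le: "\<And>u. u \<in> U \<Longrightarrow> c u \<le> d u" "\<And>w. w \<in> W \<Longrightarrow> c' w \<le> d' w"
    and free: "Ktt_free t U W {(u, w). u \<in> U \<and> w \<in> W \<and> g w \<le> f u \<and> c u \<le> d' w \<and> c' w \<le> d u}"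
  shows "card {(u, w). u \<in> U \<and> w \<in> W \<and> g w \<le> f u \<and> c u \<le> d' w \<and> c' w \<le> d u}
           \<le> 4 * t * (card U + card W)"
proof -
  let ?E = "{(u, w). u \<in> U \<and> w \<in> W \<and> g w \<le> f u \<and> c u \<le> d' w \<and> c' w \<le> d u}"
  let ?E1 = "{(u, w). u \<in> U \<and> w \<in> W \<and> g w \<le> f u \<and> c' w \<le> c u \<and> c u \<le> d' w}"
  let ?E2 = "{(w, u). w \<in> W \<and> u \<in> U \<and> - f u \<le> - g w \<and> c u \<le> c' w \<and> c' w \<le> d u}"
  have finE: "finite ?E" by (rule finite_subset[OF _ finite_cartesian_product[OF fin]]) auto
  have s1: "?E1 \<subseteq> ?E" and s2: "?E2\<inverse> \<subseteq> ?E" using le by fastforce+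
  have "card ?E1 \<le> 2 * t * (card U + card W)"
    by (rule card_three_sided_le[OF fin Ktt_free_mono[OF free order_refl order_refl s1]])
  moreover have "card ?E2 \<le> 2 * t * (card W + card U)"
  proof (rule card_three_sided_le[OF fin(2,1)])
    show "Ktt_free t W U ?E2"
      using Ktt_free_converse[OF Ktt_free_mono[OF free order_refl order_refl s2]] by simp
  qed
  moreover have "card ?E \<le> card ?E1 + card (?E2\<inverse>)"
    by (rule order_trans[OF card_mono card_Un_le])
      (use finite_subset[OF s1 finE] finite_subset[OF s2 finE] in auto)
  ultimately show ?thesis by (simp add: card_inverse algebra_simps)
qed

section \<open>Cutting intervals into blocks in base \<open>b\<close>\<close>

text \<open>The charging argument: the bounds on the pieces are linear in their vertices, so their
  sum depends only on how many pieces \<open>p\<close> a point and \<open>q\<close> a range can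
  belong to.\<close>

lemma card_edges_le_of_cover:
  assumes fin: "finite I" "finite U" "finite W" "\<And>i. i \<in> I \<Longrightarrow> finite (F i)"
    and cover: "E \<subseteq> (\<Union>i\<in>I. F i)"
    and F: "\<And>i. i \<in> I \<Longrightarrow> card (F i) \<le> K * (card {u \<in> U. Q u i} + card {w \<in> W. Q' w i})"
    and U: "\<And>u. u \<in> U \<Longrightarrow> card {i \<in> I. Q u i} \<le> p"
    and W: "\<And>w. w \<in> W \<Longrightarrow> card {i \<in> I. Q' w i} \<le> q"
  shows "card E \<le> K * (p * card U + q * card W)"
proof -
  have "card E \<le> card (\<Union>i\<in>I. F i)" using fin cover by (intro card_mono) auto
  also have "\<dots> \<le> (\<Sum>i\<in>I. card (F i))" by (rule card_UN_le[OF fin(1)])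
  also have "\<dots> \<le> (\<Sum>i\<in>I. K * (card {u \<in> U. Q u i} + card {w \<in> W. Q' w i}))"
    by (intro sum_mono F)
  also have "\<dots> = K * ((\<Sum>i\<in>I. card {u \<in> U. Q u i}) + (\<Sum>i\<in>I. card {w \<in> W. Q' w i}))"
    by (simp flip: sum_distrib_left sum.distrib)
  also have "\<dots> \<le> K * (p * card U + q * card W)"
    by (intro mult_left_mono add_mono sum_card_le_double_count fin U W) auto
  finally show ?thesis .
qed

text \<open>There are three families of pieces: left ends, right ends and full blocks. A point is
  charged at most \<open>D\<close> times in each, hence \<open>3 * D\<close>. A range is charged at
  most once for either end and at most \<open>b\<close> times for full blocks, hence
  \<open>b + 2\<close>.\<close>

lemma card_positioned_overlap_le:
  fixes c d :: "'a \<Rightarrow> real" and c' d' :: "'b \<Rightarrow> real"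
    and U :: "'a set" and W :: "'b set" and pos :: "'a \<Rightarrow> nat" and L R :: "'b \<Rightarrow> nat"
  defines "E \<equiv> {(u, w). u \<in> U \<and> w \<in> W \<and> L w \<le> pos u \<and> pos u \<le> R w \<and> c u \<le> d' w \<and> c' w \<le> d u}"
  assumes fin: "finite U" "finite W"
    and le: "\<And>u. u \<in> U \<Longrightarrow> c u \<le> d u" "\<And>w. w \<in> W \<Longrightarrow> c' w \<le> d' w"
    and b: "2 \<le> b" and D: "1 \<le> D"
    and pos: "\<And>u. u \<in> U \<Longrightarrow> pos u < b ^ D"
    and LR: "\<And>w. w \<in> W \<Longrightarrow> L w \<le> R w" "\<And>w. w \<in> W \<Longrightarrow> R w < b ^ D"
    and free: "Ktt_free t U W E"
  shows "card E \<le> 4 * t * (3 * D * card U + (b + 2) * card W)"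
proof -
  \<comment> \<open>The truncated subtraction gives level 0 to intervals with \<open>L w = R w\<close>.\<close>
  define lev where "lev w = (LEAST k. L w div b ^ k = R w div b ^ k) - 1" for w
  define lo where "lo w = L w div b ^ lev w" for w
  define hi where "hi w = R w div b ^ lev w" for w
  \<comment> \<open>At level \<open>D\<close> every rank below \<open>b ^ D\<close> lies in block 0,
    so the least level of agreement is at most \<open>D\<close>.\<close>
  have lev_less: "lev w < D" if "w \<in> W" for w
  proof -
    have "L w div b ^ D = R w div b ^ D" using LR[OF that] by simp
    then have "(LEAST k. L w div b ^ k = R w div b ^ k) \<le> D" by (rule Least_le)
    then show ?thesis using D by (simp add: lev_def)
  qed
  have lev: "hi w < lo w + b \<and> (lo w = hi w \<longrightarrow> L w = R w)" if "w \<in> W" for w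
  proof (cases "LEAST k. L w div b ^ k = R w div b ^ k")
    case 0
    have "L w div b ^ D = R w div b ^ D" using LR[OF that] by simp
    then have "L w div b ^ (LEAST k. L w div b ^ k = R w div b ^ k) =
      R w div b ^ (LEAST k. L w div b ^ k = R w div b ^ k)" by (rule LeastI)
    then show ?thesis using 0 b by (simp add: lo_def hi_def lev_def)
  next
    case (Suc k)
    have "L w div b ^ D = R w div b ^ D" using LR[OF that] by simp
    then have "L w div b ^ (LEAST k. L w div b ^ k = R w div b ^ k) =
      R w div b ^ (LEAST k. L w div b ^ k = R w div b ^ k)" by (rule LeastI)
    then have "L w div b ^ Suc k = R w div b ^ Suc k" by (simp only: Suc)
    \<comment> \<open>The ends share a block one level up, so their blocks on the level of
      \<open>w\<close> are children of the same parent and their numbers differ by less than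
      \<open>b\<close>.\<close>
    then have "lo w div b = hi w div b"
      by (simp add: lo_def hi_def lev_def Suc div_mult2_eq[symmetric] mult.commute)
    moreover have "lo w \<noteq> hi w"
      using not_less_Least[of k "\<lambda>k. L w div b ^ k = R w div b ^ k"] Suc
      by (simp add: lo_def hi_def lev_def)
    moreover have "hi w = hi w div b * b + hi w mod b" "hi w mod b < b" "lo w div b * b \<le> lo w"
      using b by (auto simp: div_times_less_eq_dividend)
    ultimately show ?thesis by (metis add_mono_thms_linordered_field(4) add.commute)
  qed
  define blk where "blk u j = pos u div b ^ j" for u j
  \<comment> \<open>Indices are pairs of a level and a block number. The crude bound
    \<open>b ^ D\<close> on block numbers serves all levels at once and does not enter the
    estimate.\<close>
  define I where "I = {..<D} \<times> {..<b ^ D}"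
  have finI: "finite I" by (simp add: I_def)
  have finE: "finite E" unfolding E_def by (rule finite_subset[OF _ finite_cartesian_product[OF fin]]) auto
  have blk_bound: "blk u j < b ^ D" if "u \<in> U" for u j
    using pos[OF that] div_le_dividend[of "pos u" "b ^ j"] unfolding blk_def by linarith
  have E_blk: "lo w \<le> blk u (lev w) \<and> blk u (lev w) \<le> hi w" if "(u, w) \<in> E" for u w
    using that by (auto simp: E_def lo_def hi_def blk_def intro: div_le_mono)
  have blk_lt: "pos u \<le> R w" if "blk u (lev w) < hi w" for u w
    using that div_le_mono[of "R w" "pos u" "b ^ lev w"] by (force simp: blk_def hi_def)
  have blk_gt: "L w \<le> pos u" if "lo w < blk u (lev w)" for u w
    using that div_le_mono[of "pos u" "L w" "b ^ lev w"] by (force simp: blk_def lo_def)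
  have lohi: "lo w \<le> hi w" if "w \<in> W" for w
    unfolding lo_def hi_def by (intro div_le_mono LR that)
  \<comment> \<open>If the ends lie in different blocks, a point in the block of one end satisfies
    the condition at the other end automatically. This is what makes the end pieces
    one-sided.\<close>
  have left_ok: "pos u \<le> R w" if "w \<in> W" "blk u (lev w) = lo w" "L w \<noteq> R w" for u w
    using blk_lt[of u w] lohi[of w] lev[of w] that by force
  have right_ok: "L w \<le> pos u" if "w \<in> W" "blk u (lev w) = hi w" "L w \<noteq> R w" for u w
    using blk_gt[of w u] lohi[of w] lev[of w] that by force
  \<comment> \<open>A one-rank interval sits on level 0, where a block is a single rank.\<close>
  have single: "L w = pos u" if "w \<in> W" "L w = R w" "blk u (lev w) = lo w" for u w
    using that by (simp add: blk_def lo_def lev_def)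
  have U_count: "card {i \<in> I. blk u (fst i) = snd i} \<le> D" if "u \<in> U" for u
  proof -
    have "{i \<in> I. blk u (fst i) = snd i} \<subseteq> (\<lambda>j. (j, blk u j)) ` {..<D}" by (auto simp: I_def)
    from surj_card_le[OF _ this] show ?thesis by simp
  qed
  let ?Y = "\<lambda>u w. c u \<le> d' w \<and> c' w \<le> d u"
  \<comment> \<open>Here \<open>Q w i\<close> says that \<open>w\<close> is charged in block
    \<open>i\<close>, and \<open>f\<close>, \<open>g\<close> carry the condition on ranks that
    remains there. The inclusion in \<open>E\<close> keeps the piece free of
    \<open>K_{t,t}\<close>.\<close>
  have piece: "card F \<le> 4 * t * (card {u \<in> U. blk u (fst i) = snd i} + card {w \<in> W. Q w i})"
    if F: "F = {(u, w). u \<in> {u \<in> U. blk u (fst i) = snd i} \<and> w \<in> {w \<in> W. Q w i}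
                  \<and> g w \<le> f u \<and> ?Y u w}" and "F \<subseteq> E"
    for F Q and f :: "'a \<Rightarrow> real" and g :: "'b \<Rightarrow> real" and i :: "nat \<times> nat"
    unfolding F
  proof (rule card_one_sided_overlap_le)
    show "Ktt_free t {u \<in> U. blk u (fst i) = snd i} {w \<in> W. Q w i}
      {(u, w). u \<in> {u \<in> U. blk u (fst i) = snd i} \<and> w \<in> {w \<in> W. Q w i} \<and> g w \<le> f u \<and> ?Y u w}"
      unfolding F[symmetric] by (rule Ktt_free_mono[OF free _ _ \<open>F \<subseteq> E\<close>]) auto
  qed (use fin le in auto)
  define El where "El = {(u, w) \<in> E. blk u (lev w) = lo w}"
  define Er where "Er = {(u, w) \<in> E. blk u (lev w) = hi w}"
  define Em where "Em = {(u, w) \<in> E. lo w < blk u (lev w) \<and> blk u (lev w) < hi w}"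
  have "card El \<le> 4 * t * (D * card U + 1 * card W)"
  proof -
    define Q where "Q w i \<longleftrightarrow> i = (lev w, lo w)" for w and i :: "nat \<times> nat"
    define F where "F i = {(u, w). u \<in> {u \<in> U. blk u (fst i) = snd i} \<and> w \<in> {w \<in> W. Q w i}
                  \<and> real (L w) \<le> real (pos u) \<and> ?Y u w}" for i
    have sub: "F i \<subseteq> E" for i
      using left_ok single LR by (fastforce simp: F_def E_def Q_def)
    show ?thesis
    proof (rule card_edges_le_of_cover[OF finI fin, where F = F and Q' = Q])
      show "El \<subseteq> (\<Union>i\<in>I. F i)"
      proof (rule subrelI)
        fix u w assume "(u, w) \<in> El"
        then have "(u, w) \<in> F (lev w, lo w)" "(lev w, lo w) \<in> I"
          using lev_less blk_bound[of u "lev w"] by (auto simp: El_def F_def Q_def I_def E_def)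
        then show "(u, w) \<in> (\<Union>i\<in>I. F i)" by blast
      qed
      show "card {i \<in> I. Q w i} \<le> 1" for w
        using card_mono[of "{(lev w, lo w)}" "{i \<in> I. Q w i}"] by (auto simp: Q_def)
      show "card (F i) \<le> 4 * t * (card {u \<in> U. blk u (fst i) = snd i} + card {w \<in> W. Q w i})" for i
        by (rule piece[OF F_def sub])
    qed (use finite_subset[OF sub finE] U_count in auto)
  qed
  moreover have "card Er \<le> 4 * t * (D * card U + 1 * card W)"
  proof -
    define Q where "Q w i \<longleftrightarrow> i = (lev w, hi w)" for w and i :: "nat \<times> nat"
    define F where "F i = {(u, w). u \<in> {u \<in> U. blk u (fst i) = snd i} \<and> w \<in> {w \<in> W. Q w i}
                  \<and> - real (R w) \<le> - real (pos u) \<and> ?Y u w}" for i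
    have sub: "F i \<subseteq> E" for i
      using right_ok single LR by (fastforce simp: F_def E_def Q_def lo_def hi_def)
    show ?thesis
    proof (rule card_edges_le_of_cover[OF finI fin, where F = F and Q' = Q])
      show "Er \<subseteq> (\<Union>i\<in>I. F i)"
      proof (rule subrelI)
        fix u w assume "(u, w) \<in> Er"
        then have "(u, w) \<in> F (lev w, hi w)" "(lev w, hi w) \<in> I"
          using lev_less blk_bound[of u "lev w"] by (auto simp: Er_def F_def Q_def I_def E_def)
        then show "(u, w) \<in> (\<Union>i\<in>I. F i)" by blast
      qed
      show "card {i \<in> I. Q w i} \<le> 1" for w
        using card_mono[of "{(lev w, hi w)}" "{i \<in> I. Q w i}"] by (auto simp: Q_def)
      show "card (F i) \<le> 4 * t * (card {u \<in> U. blk u (fst i) = snd i} + card {w \<in> W. Q w i})" for i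
        by (rule piece[OF F_def sub])
    qed (use finite_subset[OF sub finE] U_count in auto)
  qed
  moreover have "card Em \<le> 4 * t * (D * card U + b * card W)"
  proof -
    define Q where "Q w i \<longleftrightarrow> lev w = fst i \<and> lo w < snd i \<and> snd i < hi w" for w and i :: "nat \<times> nat"
    \<comment> \<open>A block strictly between those of the ends lies entirely in the interval. No
      condition on ranks remains, and the trivial inequality only fits the form of
      \<open>piece\<close>.\<close>
    define F where "F i = {(u, w). u \<in> {u \<in> U. blk u (fst i) = snd i} \<and> w \<in> {w \<in> W. Q w i}
                  \<and> (0::real) \<le> 0 \<and> ?Y u w}" for i
    have sub: "F i \<subseteq> E" for i
      using blk_lt blk_gt by (fastforce simp: F_def E_def Q_def)
    show ?thesis
    proof (rule card_edges_le_of_cover[OF finI fin, where F = F and Q' = Q])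
      show "Em \<subseteq> (\<Union>i\<in>I. F i)"
      proof (rule subrelI)
        fix u w assume "(u, w) \<in> Em"
        then have "(u, w) \<in> F (lev w, blk u (lev w))" "(lev w, blk u (lev w)) \<in> I"
          using lev_less blk_bound[of u "lev w"] by (auto simp: Em_def F_def Q_def I_def E_def)
        then show "(u, w) \<in> (\<Union>i\<in>I. F i)" by blast
      qed
      show "card {i \<in> I. Q w i} \<le> b" if "w \<in> W" for w
      proof -
        have "{i \<in> I. Q w i} \<subseteq> {lev w} \<times> {lo w<..<hi w}" by (auto simp: Q_def)
        then have "card {i \<in> I. Q w i} \<le> card ({lev w} \<times> {lo w<..<hi w})" by (intro card_mono) auto
        then show ?thesis using lev[OF that] by (simp add: card_cartesian_product, linarith)
      qed
      show "card (F i) \<le> 4 * t * (card {u \<in> U. blk u (fst i) = snd i} + card {w \<in> W. Q w i})" for i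
        by (rule piece[where f = "\<lambda>_. 0" and g = "\<lambda>_. 0", OF F_def sub])
    qed (use finite_subset[OF sub finE] U_count in auto)
  qed
  moreover have "card E \<le> card El + (card Er + card Em)"
  proof -
    have "E \<subseteq> El \<union> (Er \<union> Em)"
      using E_blk by (force simp: El_def Er_def Em_def)
    then have "card E \<le> card (El \<union> (Er \<union> Em))"
      by (intro card_mono) (auto intro: finite_subset[OF _ finE] simp: El_def Er_def Em_def)
    also have "\<dots> \<le> card El + (card Er + card Em)"
      by (meson add_left_mono card_Un_le order_trans)
    finally show ?thesis .
  qed
  ultimately show ?thesis by (simp add: algebra_simps)
qed

section \<open>From real coordinates to ranks\<close>

lemma card_less_if_extra:
  assumes "finite Y" "X \<subseteq> Y" "y \<in> Y" "y \<notin> X"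
  shows "card X < card Y"
  using assms by (intro psubset_card_mono) auto

lemma card_stabbing_overlap_le:
  fixes x c d :: "'a \<Rightarrow> real" and l r c' d' :: "'b \<Rightarrow> real" and U :: "'a set" and W :: "'b set"
  defines "E \<equiv> {(u, w). u \<in> U \<and> w \<in> W \<and> l w \<le> x u \<and> x u \<le> r w \<and> c u \<le> d' w \<and> c' w \<le> d u}"
  assumes fin: "finite U" "finite W"
    and le: "\<And>u. u \<in> U \<Longrightarrow> c u \<le> d u" "\<And>w. w \<in> W \<Longrightarrow> c' w \<le> d' w"
    and b: "2 \<le> b" and D: "1 \<le> D" "card U \<le> b ^ D"
    and free: "Ktt_free t U W E"
  shows "card E \<le> 4 * t * (3 * D * card U + (b + 2) * card W)"
proof -
  define pos where "pos u = card {v \<in> U. x v < x u}" for u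
  define L where "L w = card {v \<in> U. x v < l w}" for w
  define R where "R w = card {v \<in> U. x v \<le> r w}" for w
  \<comment> \<open>Admissible ranks run from \<open>L w\<close> to \<open>R w - 1\<close>. Keeping
    only the ranges that contain some point makes this subtraction exact: with
    \<open>L w = R w = 0\<close> the truncated bound would wrongly admit rank 0.\<close>
  define W' where "W' = {w \<in> W. L w < R w}"
  have pos_less: "pos u < card U" if "u \<in> U" for u
    unfolding pos_def using that fin by (intro card_less_if_extra[where y = u]) auto
  have L: "L w \<le> pos u \<longleftrightarrow> l w \<le> x u" if "u \<in> U" for u w
  proof
    show "L w \<le> pos u" if "l w \<le> x u"
      unfolding L_def pos_def using that fin by (intro card_mono) auto
    show "l w \<le> x u" if "L w \<le> pos u"
    proof (rule ccontr)
      assume "\<not> l w \<le> x u"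
      then have "pos u < L w"
        unfolding L_def pos_def using \<open>u \<in> U\<close> fin by (intro card_less_if_extra[where y = u]) auto
      then show False using that by simp
    qed
  qed
  have R: "pos u < R w \<longleftrightarrow> x u \<le> r w" if "u \<in> U" for u w
  proof
    show "pos u < R w" if "x u \<le> r w"
      unfolding R_def pos_def using that \<open>u \<in> U\<close> fin by (intro card_less_if_extra[where y = u]) auto
    show "x u \<le> r w" if "pos u < R w"
    proof (rule ccontr)
      assume "\<not> x u \<le> r w"
      then have "R w \<le> pos u"
        unfolding R_def pos_def using fin by (intro card_mono) auto
      then show False using that by simp
    qed
  qed
  have R_le: "R w \<le> card U" for w unfolding R_def using fin by (intro card_mono) auto
  have E: "E = {(u, w). u \<in> U \<and> w \<in> W' \<and> L w \<le> pos u \<and> pos u \<le> R w - 1 \<and> c u \<le> d' w \<and> c' w \<le> d u}"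
    (is "_ = ?E'")
  proof -
    have "(u, w) \<in> E \<longleftrightarrow> (u, w) \<in> ?E'" for u w
      using L[of u w] R[of u w] by (auto simp: E_def W'_def)
    then show ?thesis by auto
  qed
  have sub: "W' \<subseteq> W" by (auto simp: W'_def)
  have "card ?E' \<le> 4 * t * (3 * D * card U + (b + 2) * card W')"
  proof (rule card_positioned_overlap_le[OF fin(1) _ _ _ b D(1)])
    show "finite W'" using fin sub by (auto intro: finite_subset)
    show "pos u < b ^ D" if "u \<in> U" for u using pos_less[OF that] D by simp
    show "R w - 1 < b ^ D" if "w \<in> W'" for w
      using R_le[of w] D(2) that unfolding W'_def by (simp, linarith)
    show "Ktt_free t U W' ?E'"
      using Ktt_free_mono[OF free order_refl sub order_refl] by (simp only: E)
  qed (use le sub in \<open>auto simp: W'_def\<close>)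
  moreover have "card W' \<le> card W" using fin sub by (intro card_mono)
  ultimately show ?thesis
    unfolding E by (elim order_trans) (intro mult_left_mono add_left_mono, auto)
qed

section \<open>Balancing the base against the number of levels\<close>

lemma ex_branching_depth:
  assumes "3 \<le> N"
  shows "\<exists>b D. 2 \<le> b \<and> 1 \<le> D \<and> N \<le> b ^ D \<and>
           real (3 * D + b + 2) \<le> 15 * (ln (real N) / ln (ln (real N)))"
proof -
  define x where "x = ln (real N)"
  \<comment> \<open>Since 3 exceeds \<open>exp 1\<close>, the iterated logarithm in the denominator
    is positive.\<close>
  have "exp 1 < (3::real)" using e_less_272 by simp
  then have "1 < ln (3::real)" by (metis exp_gt_zero exp_less_cancel_iff exp_ln zero_less_numeral)
  also have "ln (3::real) \<le> ln (real N)" using assms by (subst ln_le_cancel_iff) auto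
  finally have x1: "1 < x" by (simp add: x_def)
  \<comment> \<open>With base about \<open>sqrt x\<close>, \<open>ln b\<close> is still at least
    half of \<open>ln x\<close>, so the depth is of order \<open>q\<close>, while \<open>b\<close>
    itself stays below that order.\<close>
  define b where "b = nat \<lceil>sqrt x\<rceil> + 1"
  define D where "D = nat \<lceil>x / ln b\<rceil>"
  define q where "q = x / ln x"
  have s1: "1 < sqrt x" using x1 by simp
  have lnx: "0 < ln x" using x1 by simp
  have b2: "2 \<le> b" and b_ge: "sqrt x \<le> b" and b_le: "b \<le> sqrt x + 2"
    using s1 unfolding b_def by linarith+
  have half: "ln (sqrt x) = ln x / 2" using x1 by (simp add: ln_sqrt)
  have lnb: "ln x / 2 \<le> ln b" using b_ge s1 half
    by (metis ln_le_cancel_iff less_trans zero_less_one order_less_le_trans)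
  have "0 < ln b" using lnb lnx by linarith
  then have "0 < x / ln b" using x1 by (intro divide_pos_pos) auto
  then have D_ge: "x / ln b \<le> D" and D_le: "D \<le> x / ln b + 1"
    unfolding D_def by linarith+
  have D1: "1 \<le> D" using D_ge \<open>0 < x / ln b\<close> by linarith
  have "x \<le> D * ln b" using D_ge lnb lnx by (simp add: field_simps)
  then have "exp x \<le> exp (D * ln b)" by simp
  also have "exp (D * ln b) = real b ^ D" using b2 by (simp add: exp_of_nat_mult)
  finally have "real N \<le> real (b ^ D)" using assms by (simp add: x_def)
  then have N: "N \<le> b ^ D" by (simp only: of_nat_le_iff)
  have "x / ln b \<le> x / (ln x / 2)" using lnx x1 by (intro frac_le lnb) auto
  then have D_q: "D \<le> 2 * q + 1" using D_le by (simp add: q_def mult.commute)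
  have "ln x \<le> 2 * sqrt x" using half ln_le_minus_one[of "sqrt x"] s1 by simp
  then have "sqrt x * ln x \<le> sqrt x * (2 * sqrt x)" using s1 by (intro mult_left_mono) auto
  also have "\<dots> = 2 * x" using x1 by simp
  finally have b_q: "sqrt x \<le> 2 * q" using lnx by (simp add: q_def field_simps)
  have q1: "1 \<le> q" using ln_le_minus_one[of x] x1 lnx by (simp add: q_def field_simps)
  \<comment> \<open>From \<open>D \<le> 2 * q + 1\<close> and \<open>b \<le> 2 * q + 2\<close> the
    left side is at most \<open>8 * q + 7\<close>, and \<open>1 \<le> q\<close> absorbs the
    7.\<close>
  have "real (3 * D + b + 2) \<le> 15 * q" using D_q b_le b_q q1 by simp
  then show ?thesis using b2 D1 N unfolding q_def x_def by blast
qed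

section \<open>Rectangle intersections as two stabbing problems\<close>

theorem theorem5:
  "\<exists>C::real. C > 0 \<and>
     (\<forall>(t::nat) (n::nat) (m::nat) (A :: (real \<times> real) set set) (B :: (real \<times> real) set set).
        t \<ge> 2 \<longrightarrow> n + m \<ge> 3 \<longrightarrow>
        finite A \<longrightarrow> finite B \<longrightarrow> card A = n \<longrightarrow> card B = m \<longrightarrow>
        (\<forall>R\<in>A \<union> B. axis_parallel_rectangle R) \<longrightarrow>
        general_position (A \<union> B) \<longrightarrow>
        Ktt_free t A B (intersection_edges A B) \<longrightarrow>
        real (card (intersection_edges A B)) \<le>
          C * (real t * real (n + m) * (ln (real (n + m)) / ln (ln (real (n + m))))
               + real t ^ 6 * real n + real t * real m))"
proof (rule exI[of _ 60], intro conjI allI impI)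
  fix t n m :: nat and A B :: "(real \<times> real) set set"
  assume nm: "3 \<le> n + m" and fin: "finite A" "finite B" and card: "card A = n" "card B = m"
    and rect: "\<forall>R\<in>A \<union> B. axis_parallel_rectangle R"
    and free: "Ktt_free t A B (intersection_edges A B)"
  let ?E = "intersection_edges A B"
  have "\<forall>R\<in>A \<union> B. \<exists>a b c d. a \<le> b \<and> c \<le> d \<and> R = {a..b} \<times> {c..d}"
    using rect unfolding axis_parallel_rectangle_def by (meson less_imp_le)
  then obtain l r c d where box: "\<And>R. R \<in> A \<union> B \<Longrightarrow> l R \<le> r R \<and> c R \<le> d R \<and> R = {l R..r R} \<times> {c R..d R}"
    by metis
  have meet: "P \<inter> Q \<noteq> {} \<longleftrightarrow> l P \<le> r Q \<and> l Q \<le> r P \<and> c P \<le> d Q \<and> c Q \<le> d P"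
    if "P \<in> A \<union> B" "Q \<in> A \<union> B" for P Q
  proof -
    have "P \<inter> Q = ({l P..r P} \<inter> {l Q..r Q}) \<times> ({c P..d P} \<inter> {c Q..d Q})"
      using box[OF that(1)] box[OF that(2)] by (metis Times_Int_Times)
    then show ?thesis using box[OF that(1)] box[OF that(2)]
      by (simp add: Int_atLeastAtMost) blast
  qed
  obtain b D where bD: "2 \<le> b" "1 \<le> D" "n + m \<le> b ^ D"
    and cost: "real (3 * D + b + 2) \<le> 15 * (ln (real (n + m)) / ln (ln (real (n + m))))"
    using ex_branching_depth[OF nm] by blast
  \<comment> \<open>The larger of the two left ends lies in the other x-interval. It belongs to the
    rectangle from \<open>A\<close> in \<open>?E1\<close> and to the one from \<open>B\<close> in
    \<open>?E2\<close>.\<close>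
  let ?E1 = "{(u, w). u \<in> A \<and> w \<in> B \<and> l w \<le> l u \<and> l u \<le> r w \<and> c u \<le> d w \<and> c w \<le> d u}"
  let ?E2 = "{(u, w). u \<in> B \<and> w \<in> A \<and> l w \<le> l u \<and> l u \<le> r w \<and> c u \<le> d w \<and> c w \<le> d u}"
  have s1: "?E1 \<subseteq> ?E"
  proof (rule subrelI)
    fix u w assume "(u, w) \<in> ?E1"
    then show "(u, w) \<in> ?E" using meet[of u w] box[of u] by (auto simp: intersection_edges_def)
  qed
  have s2: "?E2\<inverse> \<subseteq> ?E"
  proof (rule subrelI)
    fix w u assume "(w, u) \<in> ?E2\<inverse>"
    then show "(w, u) \<in> ?E" using meet[of w u] box[of u] by (auto simp: intersection_edges_def)
  qed
  have s: "?E \<subseteq> ?E1 \<union> ?E2\<inverse>"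
  proof (rule subrelI)
    fix u w assume "(u, w) \<in> ?E"
    then show "(u, w) \<in> ?E1 \<union> ?E2\<inverse>" using meet[of u w] by (auto simp: intersection_edges_def)
  qed
  have finE: "finite ?E"
    by (rule finite_subset[OF _ finite_cartesian_product[OF fin]]) (auto simp: intersection_edges_def)
  have "card ?E1 \<le> 4 * t * (3 * D * card A + (b + 2) * card B)"
    by (rule card_stabbing_overlap_le[OF fin _ _ bD(1,2) _ Ktt_free_mono[OF free order_refl order_refl s1]])
      (use box bD(3) card in auto)
  moreover have "card ?E2 \<le> 4 * t * (3 * D * card B + (b + 2) * card A)"
  proof (rule card_stabbing_overlap_le[OF fin(2,1) _ _ bD(1,2)])
    show "Ktt_free t B A ?E2"
      using Ktt_free_converse[OF Ktt_free_mono[OF free order_refl order_refl s2]] by simp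
  qed (use box bD(3) card in auto)
  moreover have "card ?E \<le> card ?E1 + card (?E2\<inverse>)"
    by (rule order_trans[OF card_mono[OF _ s] card_Un_le])
      (use finite_subset[OF s1 finE] finite_subset[OF s2 finE] in simp)
  \<comment> \<open>Each family supplies the points once and the ranges once, so both sizes get the
    coefficient \<open>3 * D + b + 2\<close>. With \<open>cost\<close> this yields the constant 60
    as 4 times 15.\<close>
  ultimately have "card ?E \<le> 4 * t * ((3 * D + b + 2) * (n + m))"
    by (simp add: card_inverse card algebra_simps)
  then have "real (card ?E) \<le> real (4 * t * ((3 * D + b + 2) * (n + m)))"
    by (simp only: of_nat_le_iff)
  also have "\<dots> = 4 * real t * (real (3 * D + b + 2) * real (n + m))"
    by (simp only: of_nat_mult of_nat_numeral)
  also have "\<dots> \<le> 4 * real t * (15 * (ln (real (n + m)) / ln (ln (real (n + m)))) * real (n + m))"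
    by (intro mult_left_mono mult_right_mono cost) auto
  also have "\<dots> = 60 * (real t * real (n + m) * (ln (real (n + m)) / ln (ln (real (n + m)))))"
    by simp
  also have "\<dots> \<le> 60 * (real t * real (n + m) * (ln (real (n + m)) / ln (ln (real (n + m))))
               + real t ^ 6 * real n + real t * real m)"
    by (intro mult_left_mono) auto
  finally show "real (card ?E) \<le> 60 * (real t * real (n + m) * (ln (real (n + m)) / ln (ln (real (n + m))))
               + real t ^ 6 * real n + real t * real m)" .
qed simp

end
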